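(* Let $G$ be a weighted graph on vertex set $[n]$, i.e. a finite simple undirected graph together with a weight function $w:E(G)\to\mathbb{R}$, and let $A(G)=[a_{ij}]$ be its adjacency matrix ($a_{ij}=w(e)$ if $e=ij\in E(G)$ and $a_{ij}=0$ otherwise). Let $\lambda(G)$ be the spectral radius of $A(G)$. Then \[ \lambda(G) \leq \sqrt{2 \sum_{e\in E(G)} \frac{\mathrm{cl}(e) - 1}{\mathrm{cl}(e)}\, w(e)^2}. \] Equality holds if and only if $G$ is, up to isolated vertices, a complete $r$-partite graph for some $r$ (with partition $V_1\cup V_2\cup\cdots\cup V_r$), and there exists a vector $\bm{w}\in\mathbb{R}^n$ such that (1) $A(G) = \pm\sum_{i=1}^r (\bm{1}_{V_i}\circ\bm{w}) \big((\bm{1} - \bm{1}_{V_i})\circ\bm{w}\big)^{\mathrm{T}}$; and (2) $\|\bm{1}_{V_i}\circ\bm{w}\|^2 = \|\bm{w}\|^2 - \sqrt{1-1/r} \cdot \|A(G)\|_F$ for each $i\in [r]$.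
   Context: For an edge $e$ of $G$, $\mathrm{cl}(e)$ denotes the order of the largest clique of (the underlying graph of) $G$ containing $e$. The spectral radius $\lambda(G)$ is the maximum absolute value of the eigenvalues of $A(G)$. $\|M\|_F=(\sum_{i,j} m_{ij}^2)^{1/2}$ is the Frobenius norm; $\circ$ denotes the Hadamard (entrywise) product; for $S\subseteq[n]$, $\bm{1}_S\in\{0,1\}^n$ is the characteristic vector of $S$; $\bm{1}$ is the all-ones vector; $\|\cdot\|$ is the Euclidean norm.
   Formalization: The "only if" half of the equality case is proved for graphs whose edge weights are all nonzero; with zero weights it fails, e.g. two disjoint edges of weights 1 and 0 attain equality but are not complete multipartite up to isolated vertices. *)

theory Defs
  imports
    "Jordan_Normal_Form.Spectral_Radius"
    "HOL-Library.Ramsey"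
    "HOL-Library.Disjoint_Sets"
begin

text \<open>The vertex set is \<open>{..<n}\<close>, matching the 0-based indices of vectors and matrices.
  An edge is a 2-element set of vertices; a weighted graph is an edge set together with a weight
  function, of which only the values on edges matter.\<close>

definition simple_graph :: "nat \<Rightarrow> nat set set \<Rightarrow> bool" where
  "simple_graph n E \<longleftrightarrow> E \<subseteq> nsets {..<n} 2"

definition adj_mat :: "nat \<Rightarrow> nat set set \<Rightarrow> (nat set \<Rightarrow> real) \<Rightarrow> real mat" where
  "adj_mat n E w = mat n n (\<lambda>(i, j). if {i, j} \<in> E then w {i, j} else 0)"

definition cl :: "nat \<Rightarrow> nat set set \<Rightarrow> nat set \<Rightarrow> nat" where
  "cl n E e = Max {card C | C. C \<subseteq> {..<n} \<and> clique C E \<and> e \<subseteq> C}"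

text \<open>\<^const>\<open>spectral_radius\<close> is the largest modulus of a complex eigenvalue; the adjacency matrix
  is real symmetric, so all of its complex eigenvalues are real.\<close>

definition graph_spectral_radius :: "nat \<Rightarrow> nat set set \<Rightarrow> (nat set \<Rightarrow> real) \<Rightarrow> real" where
  "graph_spectral_radius n E w = spectral_radius (map_mat complex_of_real (adj_mat n E w))"

definition complete_multipartite ::
    "nat set \<Rightarrow> nat set set \<Rightarrow> nat \<Rightarrow> (nat \<Rightarrow> nat set) \<Rightarrow> bool" where
  "complete_multipartite X E r V \<longleftrightarrow>
     (\<forall>i<r. V i \<noteq> {}) \<and> disjoint_family_on V {..<r} \<and> (\<Union>i<r. V i) = X \<and>
     E = {{u, v} | u v. \<exists>i<r. \<exists>j<r. i \<noteq> j \<and> u \<in> V i \<and> v \<in> V j}"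

text \<open>Deleting some isolated vertices leaves a complete multipartite graph on the remaining
  vertex set \<open>X\<close>. A single part (\<open>r = 1\<close>) describes the edgeless graph.\<close>

definition complete_multipartite_up_to_isolated ::
    "nat \<Rightarrow> nat set set \<Rightarrow> nat \<Rightarrow> (nat \<Rightarrow> nat set) \<Rightarrow> bool" where
  "complete_multipartite_up_to_isolated n E r V \<longleftrightarrow>
     (\<exists>X \<subseteq> {..<n}. (\<forall>v \<in> {..<n} - X. \<forall>e\<in>E. v \<notin> e) \<and> complete_multipartite X E r V)"

definition euclidean_norm :: "real vec \<Rightarrow> real" where
  "euclidean_norm v = sqrt (\<Sum>i<dim_vec v. (v $ i)\<^sup>2)"

definition frobenius_norm :: "real mat \<Rightarrow> real" where
  "frobenius_norm M = sqrt (\<Sum>i<dim_row M. \<Sum>j<dim_col M. (M $$ (i, j))\<^sup>2)"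

definition ones_vec :: "nat \<Rightarrow> real vec" where
  "ones_vec n = vec n (\<lambda>_. 1)"

definition char_vec :: "nat \<Rightarrow> nat set \<Rightarrow> real vec" where
  "char_vec n S = vec n (\<lambda>i. if i \<in> S then 1 else 0)"

definition hadamard_vec :: "real vec \<Rightarrow> real vec \<Rightarrow> real vec" where
  "hadamard_vec u v = vec (dim_vec u) (\<lambda>i. u $ i * v $ i)"

definition outer_prod :: "real vec \<Rightarrow> real vec \<Rightarrow> real mat" where
  "outer_prod u v = mat (dim_vec u) (dim_vec v) (\<lambda>(i, j). u $ i * v $ j)"

text \<open>Type \<^typ>\<open>real mat\<close> has no zero element independent of the dimensions, so
  \<^const>\<open>sum\<close> is not available on it.\<close>

definition sum_of_mats :: "nat \<Rightarrow> (nat \<Rightarrow> real mat) \<Rightarrow> nat set \<Rightarrow> real mat" where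
  "sum_of_mats n F I = mat n n (\<lambda>(i, j). \<Sum>k\<in>I. F k $$ (i, j))"

definition extremal_structure :: "nat \<Rightarrow> nat set set \<Rightarrow> (nat set \<Rightarrow> real) \<Rightarrow> bool" where
  "extremal_structure n E w \<longleftrightarrow>
     (\<exists>r\<ge>1. \<exists>V. complete_multipartite_up_to_isolated n E r V \<and>
       (\<exists>x \<in> carrier_vec n. \<exists>s \<in> {1, -1::real}.
          adj_mat n E w = s \<cdot>\<^sub>m sum_of_mats n
            (\<lambda>i. outer_prod (hadamard_vec (char_vec n (V i)) x)
                            (hadamard_vec (ones_vec n - char_vec n (V i)) x)) {..<r} \<and>
          (\<forall>i<r. (euclidean_norm (hadamard_vec (char_vec n (V i)) x))\<^sup>2
                 = (euclidean_norm x)\<^sup>2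
                   - sqrt (1 - 1 / real r) * frobenius_norm (adj_mat n E w))))"

end

theory Submission
  imports Defs "HOL-Analysis.Convex"
begin

text \<open>For an eigenvector \<open>x\<close> of the eigenvalue of largest modulus, weighted Cauchy-Schwarz bounds
  \<open>x\<^sup>T A x\<close> by the claimed bound times the square root of \<open>q(y)\<close>, where \<open>y = x\<^sup>2\<close> entrywise and
  \<open>q\<close> is the quadratic form with coefficient \<open>cl(e) / (cl(e) - 1)\<close> on each edge \<open>e\<close>. The localized
  Motzkin-Straus inequality \<open>q(y) \<le> (\<Sum> y)\<^sup>2\<close> follows by moving all weight between two nonadjacent
  vertices, along which \<open>q\<close> is affine, until the support is a clique. In the equality case \<open>y\<close>
  maximizes \<open>q\<close>: the second-order condition makes nonadjacency transitive on the support, hence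
  the graph complete multipartite, and the first-order condition gives all parts equal weight.\<close>

section \<open>Quadratic forms and the localized Motzkin-Straus inequality\<close>

text \<open>The sum runs over ordered pairs, so for symmetric \<open>b\<close> the inner sum is half
  the partial derivative at \<open>u\<close>. With coefficient k/(k - 1) on a clique of order k,
  uniform weights 1/k give the value 1.\<close>

definition quad_form :: "'a set \<Rightarrow> ('a \<Rightarrow> 'a \<Rightarrow> real) \<Rightarrow> ('a \<Rightarrow> real) \<Rightarrow> real" where
  "quad_form V b y = (\<Sum>u\<in>V. y u * (\<Sum>v\<in>V. y v * b u v))"

text \<open>The second-order Taylor expansion of a quadratic form is exact, and symmetry merges the
  two cross terms. The perturbation arguments below compare values through it.\<close>

lemma quad_form_add:
  assumes sym: "\<And>u v. b u v = b v u"
  shows "quad_form V b (\<lambda>u. y u + z u)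
    = quad_form V b y + 2 * (\<Sum>u\<in>V. z u * (\<Sum>v\<in>V. y v * b u v)) + quad_form V b z"
proof -
  have "(\<Sum>u\<in>V. y u * (\<Sum>v\<in>V. z v * b u v)) = (\<Sum>u\<in>V. \<Sum>v\<in>V. y u * (z v * b u v))"
    by (simp add: sum_distrib_left)
  also have "\<dots> = (\<Sum>v\<in>V. \<Sum>u\<in>V. y u * (z v * b u v))"
    by (rule sum.swap)
  also have "\<dots> = (\<Sum>v\<in>V. z v * (\<Sum>u\<in>V. y u * b v u))"
    by (simp add: sum_distrib_left mult_ac sym)
  finally show ?thesis
    unfolding quad_form_def by (simp add: algebra_simps sum.distrib)
qed

lemma sum_single_mult:
  fixes g :: "'a \<Rightarrow> real"
  assumes "finite V" "u \<in> V"
  shows "(\<Sum>w\<in>V. (if w = u then a else 0) * g w) = a * g u"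
  using assms by (simp add: if_distrib[where f = "\<lambda>x. x * _"] cong: if_cong)

text \<open>Cauchy-Schwarz against the constant 1 on the support.\<close>

lemma sum_squared_le_card_support:
  fixes y :: "'a \<Rightarrow> real"
  assumes "finite V"
  shows "(\<Sum>u\<in>V. y u)\<^sup>2 \<le> real (card {u\<in>V. y u \<noteq> 0}) * (\<Sum>u\<in>V. (y u)\<^sup>2)"
proof -
  let ?S = "{u\<in>V. y u \<noteq> 0}"
  have 1: "(\<Sum>u\<in>V. y u) = (\<Sum>u\<in>?S. y u)" and 2: "(\<Sum>u\<in>V. (y u)\<^sup>2) = (\<Sum>u\<in>?S. (y u)\<^sup>2)"
    using assms by (auto intro!: sum.mono_neutral_right)
  show ?thesis
    unfolding 1 2 using Cauchy_Schwarz_ineq_sum[of "\<lambda>_. 1" y ?S] by simp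
qed

text \<open>Strong induction on the size of the support. Once the support is a clique of order k
  \<ge> 2, every coefficient on it is at most c = k/(k - 1). With T and Q the sums of
  \<open>y\<close> and of its squares, Q \<ge> T^2/k gives c * (T^2 - Q) \<le> T^2.\<close>

lemma localized_motzkin_straus:
  assumes fin: "finite V" and sym: "\<And>u v. b u v = b v u" and diag: "\<And>u. b u u = 0"
    and clq: "\<And>S u v. S \<subseteq> V \<Longrightarrow> (\<forall>p\<in>S. \<forall>q\<in>S. p \<noteq> q \<longrightarrow> b p q \<noteq> 0) \<Longrightarrow> u \<in> S \<Longrightarrow> v \<in> S \<Longrightarrow> u \<noteq> v
      \<Longrightarrow> b u v \<le> real (card S) / (real (card S) - 1)"
    and nonneg: "\<And>u. u \<in> V \<Longrightarrow> 0 \<le> y u"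
  shows "quad_form V b y \<le> (\<Sum>u\<in>V. y u)\<^sup>2"
  using nonneg
proof (induction "card {u\<in>V. y u \<noteq> 0}" arbitrary: y rule: less_induct)
  case less
  note nonneg = less.prems
  define S where "S = {u\<in>V. y u \<noteq> 0}"
  have finS: "finite S" using fin by (simp add: S_def)
  show ?case
  proof (cases "\<forall>p\<in>S. \<forall>q\<in>S. p \<noteq> q \<longrightarrow> b p q \<noteq> 0")
    case False
    let ?D = "\<lambda>u. \<Sum>v\<in>V. y v * b u v"
    \<comment> \<open>By symmetry the nonadjacent pair can be ordered so that the gradient at
      \<open>u\<close> is at least that at \<open>v\<close>; moving weight from \<open>v\<close> to
      \<open>u\<close> then does not decrease the form.\<close>
    obtain u v where uv: "u \<in> S" "v \<in> S" "u \<noteq> v" "b u v = 0" "?D v \<le> ?D u"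
      using False sym by (metis linear)
    have V: "u \<in> V" "v \<in> V" using uv by (auto simp: S_def)
    define z where "z = (\<lambda>w. (if w = u then y v else 0) + (if w = v then - y v else 0))"
    have z: "(\<Sum>w\<in>V. z w * g w) = y v * (g u - g v)" for g
      using fin V by (simp only: z_def distrib_right sum.distrib sum_single_mult) (simp add: algebra_simps)
    \<comment> \<open>Only diagonal entries and entries between the nonadjacent \<open>u\<close> and
      \<open>v\<close> occur, so the form is affine along \<open>z\<close>.\<close>
    have "quad_form V b z = 0"
      unfolding quad_form_def z using uv sym[of v u] by (simp add: diag)
    then have "quad_form V b (\<lambda>w. y w + z w) = quad_form V b y + 2 * (y v * (?D u - ?D v))"
      by (subst quad_form_add[OF sym]) (simp add: z)
    moreover have "0 \<le> y v * (?D u - ?D v)"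
      using uv nonneg V by simp
    ultimately have le: "quad_form V b y \<le> quad_form V b (\<lambda>w. y w + z w)"
      by linarith
    \<comment> \<open>\<open>v\<close> leaves the support, and \<open>u\<close> was already in
      it.\<close>
    have "{w\<in>V. y w + z w \<noteq> 0} \<subset> S"
      using uv V by (auto simp: S_def z_def)
    then have "card {w\<in>V. y w + z w \<noteq> 0} < card S"
      using finS by (rule psubset_card_mono[rotated])
    moreover have "0 \<le> y w + z w" if "w \<in> V" for w
      using nonneg[OF that] nonneg[OF V(2)] by (auto simp: z_def)
    ultimately have "quad_form V b (\<lambda>w. y w + z w) \<le> (\<Sum>w\<in>V. y w + z w)\<^sup>2"
      using less.hyps[of "\<lambda>w. y w + z w"] by (simp add: S_def)
    also have "(\<Sum>w\<in>V. y w + z w) = (\<Sum>w\<in>V. y w)"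
      using z[of "\<lambda>_. 1"] by (simp add: sum.distrib)
    finally show ?thesis using le by simp
  next
    case True
    let ?k = "real (card S)" and ?T = "\<Sum>u\<in>V. y u" and ?Q = "\<Sum>u\<in>V. (y u)\<^sup>2"
    show ?thesis
    proof (cases "card S \<ge> 2")
      case False
      \<comment> \<open>With at most one vertex in the support, only diagonal terms could
        contribute, and these vanish.\<close>
      then have eq: "u = v" if "u \<in> S" "v \<in> S" for u v
        using that finS card_le_Suc0_iff_eq[of S] by auto
      have "y u * (y v * b u v) = 0" if "u \<in> V" "v \<in> V" for u v
        using eq[of u v] diag that by (auto simp: S_def)
      then have "quad_form V b y = 0"
        unfolding quad_form_def by (simp add: sum_distrib_left)
      then show ?thesis by simp
    next
      case k: True
      define c where "c = ?k / (?k - 1)"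
      have c: "c \<ge> 0" "c * (1 - 1 / ?k) = 1" using k by (auto simp: c_def field_simps)
      \<comment> \<open>Subtracting the square on the diagonal makes both sides 0 at
        \<open>u = v\<close>, and the right-hand sides add up to c * (T^2 - Q).\<close>
      have "y u * (y v * b u v) \<le> c * (y u * y v - (if v = u then (y u)\<^sup>2 else 0))"
        if "u \<in> V" "v \<in> V" for u v
      proof (cases "u \<in> S \<and> v \<in> S \<and> u \<noteq> v")
        case True
        have "b u v \<le> c"
          unfolding c_def using True \<open>\<forall>p\<in>S. _\<close> by (intro clq) (auto simp: S_def)
        then have "(y u * y v) * b u v \<le> (y u * y v) * c"
          using nonneg that by (intro mult_left_mono) auto
        then show ?thesis using True by (auto simp: mult_ac)
      next
        case False
        then show ?thesis using that by (auto simp: S_def diag power2_eq_square)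
      qed
      then have "quad_form V b y \<le> (\<Sum>u\<in>V. \<Sum>v\<in>V. c * (y u * y v - (if v = u then (y u)\<^sup>2 else 0)))"
        unfolding quad_form_def sum_distrib_left by (intro sum_mono)
      also have "\<dots> = c * (?T\<^sup>2 - ?Q)"
        using fin by (simp add: sum_distrib_left[symmetric] sum_subtractf sum_distrib_right[symmetric] power2_eq_square)
      also have "\<dots> \<le> c * (?T\<^sup>2 - ?T\<^sup>2 / ?k)"
        using sum_squared_le_card_support[OF fin, of y] k c
        by (intro mult_left_mono) (auto simp: S_def field_simps)
      also have "\<dots> = c * (1 - 1 / ?k) * ?T\<^sup>2" by (simp add: algebra_simps)
      finally show ?thesis using c by simp
    qed
  qed
qed

section \<open>Optimality conditions at a maximizer\<close>

text \<open>No half-gradient \<open>?D w\<close> exceeds the total \<open>?T\<close>, since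
  otherwise raising \<open>y w\<close> alone would violate the inequality. The sum of
  \<open>?T - ?D w\<close> weighted by \<open>y w\<close> is 0 by the assumed equality, so each
  difference with positive weight vanishes.\<close>

lemma quad_form_gradient_at_maximizer:
  assumes fin: "finite V" and sym: "\<And>u v. b u v = b v u" and diag: "\<And>u. b u u = 0"
    and le: "\<And>y. (\<And>u. u \<in> V \<Longrightarrow> 0 \<le> y u) \<Longrightarrow> quad_form V b y \<le> (\<Sum>u\<in>V. y u)\<^sup>2"
    and nonneg: "\<And>u. u \<in> V \<Longrightarrow> 0 \<le> y u"
    and eq: "quad_form V b y = (\<Sum>u\<in>V. y u)\<^sup>2"
    and u: "u \<in> V" "y u > 0"
  shows "(\<Sum>v\<in>V. y v * b u v) = (\<Sum>v\<in>V. y v)"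
proof -
  let ?D = "\<lambda>u. \<Sum>v\<in>V. y v * b u v" and ?T = "\<Sum>u\<in>V. y u"
  have D: "?D w \<le> ?T" if w: "w \<in> V" for w
  proof (rule ccontr)
    assume gt: "\<not> ?thesis"
    \<comment> \<open>Raising \<open>y w\<close> by t adds 2 * t * \<open>?D w\<close> to the form
      and 2 * t * \<open>?T\<close> + t^2 to the squared sum; this choice of t turns the inequality
      into 2 * t^2 \<le> t^2.\<close>
    define t where "t = ?D w - ?T"
    have t: "t > 0" using gt by (simp add: t_def)
    define z where "z = (\<lambda>v. if v = w then t else 0)"
    have z: "(\<Sum>v\<in>V. z v * g v) = t * g w" for g
      unfolding z_def using fin w by (rule sum_single_mult)
    have "quad_form V b z = 0"
      unfolding quad_form_def z by (simp add: diag)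
    then have "quad_form V b (\<lambda>v. y v + z v) = ?T\<^sup>2 + 2 * (t * ?D w)"
      by (subst quad_form_add[OF sym]) (simp add: z eq)
    moreover have "quad_form V b (\<lambda>v. y v + z v) \<le> (\<Sum>v\<in>V. y v + z v)\<^sup>2"
      using nonneg t by (intro le) (auto simp: z_def add_nonneg_nonneg)
    moreover have "(\<Sum>v\<in>V. y v + z v) = ?T + t"
      using z[of "\<lambda>_. 1"] by (simp add: sum.distrib)
    ultimately have "2 * (t * ?D w) \<le> 2 * (t * ?T) + t * t"
      by (simp add: power2_eq_square algebra_simps)
    then have "t * t \<le> 0" by (simp add: t_def algebra_simps)
    then show False using t by (simp add: mult_le_0_iff)
  qed
  have "(\<Sum>w\<in>V. y w * (?T - ?D w)) = ?T * ?T - quad_form V b y"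
    by (simp add: quad_form_def right_diff_distrib sum_subtractf sum_distrib_right)
  also have "\<dots> = 0" using eq by (simp add: power2_eq_square)
  finally have "y u * (?T - ?D u) = 0"
    using fin u nonneg D by (subst (asm) sum_nonneg_eq_0_iff) auto
  then show ?thesis using u by simp
qed

text \<open>Along \<open>e\<^sub>u + e\<^sub>z - 2 e\<^sub>v\<close> the sum of the entries is constant and the gradient vanishes, so the
  second-order term \<open>2 b u z\<close> decides.\<close>

lemma quad_form_maximizer_nonadjacency_trans:
  assumes fin: "finite V" and sym: "\<And>u v. b u v = b v u" and diag: "\<And>u. b u u = 0"
    and le: "\<And>y. (\<And>u. u \<in> V \<Longrightarrow> 0 \<le> y u) \<Longrightarrow> quad_form V b y \<le> (\<Sum>u\<in>V. y u)\<^sup>2"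
    and nonneg: "\<And>u. u \<in> V \<Longrightarrow> 0 \<le> y u"
    and eq: "quad_form V b y = (\<Sum>u\<in>V. y u)\<^sup>2"
    and V: "u \<in> V" "v \<in> V" "z \<in> V" and pos: "y u > 0" "y v > 0" "y z > 0"
    and nadj: "b u v = 0" "b v z = 0"
  shows "b u z \<le> 0"
proof -
  let ?D = "\<lambda>u. \<Sum>v\<in>V. y v * b u v" and ?T = "\<Sum>u\<in>V. y u"
  \<comment> \<open>With half of \<open>y v\<close>, the decrease 2 * t at \<open>v\<close> does not
    exceed its weight, so the perturbed weights stay nonnegative.\<close>
  define t where "t = y v / 2"
  have t: "t > 0" using pos by (simp add: t_def)
  define d where "d = (\<lambda>w. (if w = u then t else 0) + (if w = z then t else 0)
    + (if w = v then - 2 * t else 0))"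
  have d: "(\<Sum>w\<in>V. d w * g w) = t * (g u + g z - 2 * g v)" for g
    using fin V by (simp only: d_def distrib_right sum.distrib sum_single_mult) (simp add: algebra_simps)
  have D: "?D w = ?T" if "w \<in> V" "y w > 0" for w
    using fin sym diag le nonneg eq that by (rule quad_form_gradient_at_maximizer)
  have "quad_form V b d = 2 * (t * t) * b u z"
    unfolding quad_form_def d using nadj sym[of v u] sym[of z v] sym[of z u]
    by (simp add: diag algebra_simps)
  then have "quad_form V b (\<lambda>w. y w + d w) = ?T\<^sup>2 + 2 * (t * t) * b u z"
    using V pos by (subst quad_form_add[OF sym]) (simp add: d eq D)
  moreover have "quad_form V b (\<lambda>w. y w + d w) \<le> (\<Sum>w\<in>V. y w + d w)\<^sup>2"
    using nonneg t by (intro le) (auto simp: d_def t_def add_nonneg_nonneg)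
  moreover have "(\<Sum>w\<in>V. y w + d w) = ?T"
    using d[of "\<lambda>_. 1"] by (simp add: sum.distrib)
  ultimately have "2 * (t * t) * b u z \<le> 0" by simp
  then show ?thesis using t by (simp add: mult_le_0_iff)
qed

section \<open>Eigenvalues and spectral radius of real symmetric matrices\<close>

lemma mult_mat_vec_eq_smult_iff:
  fixes A :: "'a::comm_ring_1 mat"
  assumes "A \<in> carrier_mat n n" "v \<in> carrier_vec n"
  shows "A *\<^sub>v v = k \<cdot>\<^sub>v v \<longleftrightarrow> (\<forall>i<n. (\<Sum>j<n. A $$ (i, j) * v $ j) = k * v $ i)"
  using assms by (auto simp: vec_eq_iff scalar_prod_def lessThan_atLeast0 row_def)

text \<open>A complex eigenvalue k of largest modulus is real because the Hermitian form of a real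
  symmetric matrix takes real values. The real and imaginary parts of its eigenvector then satisfy
  the eigenvalue equation separately, and one of them is nonzero.\<close>

lemma spectral_radius_symmetric_eigenvector:
  fixes A :: "real mat"
  assumes A: "A \<in> carrier_mat n n" and n: "n > 0"
    and sym: "\<And>i j. i < n \<Longrightarrow> j < n \<Longrightarrow> A $$ (i, j) = A $$ (j, i)"
  obtains \<mu> x where "spectral_radius (map_mat complex_of_real A) = \<bar>\<mu>\<bar>" and "\<exists>i<n. x i \<noteq> 0"
    and "\<And>i. i < n \<Longrightarrow> (\<Sum>j<n. A $$ (i, j) * x j) = \<mu> * x i"
proof -
  let ?A = "map_mat complex_of_real A"
  have A': "?A \<in> carrier_mat n n" using A by simp
  obtain k where k: "k \<in> spectrum ?A" and sr: "spectral_radius ?A = cmod k"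
    using spectral_radius_mem_max(1)[OF A' n] by auto
  obtain v where v: "v \<in> carrier_vec n" "v \<noteq> 0\<^sub>v n" "?A *\<^sub>v v = k \<cdot>\<^sub>v v"
    using k A by (auto simp: spectrum_def eigenvalue_def eigenvector_def)
  have ev: "(\<Sum>j<n. complex_of_real (A $$ (i, j)) * v $ j) = k * v $ i" if "i < n" for i
    using mult_mat_vec_eq_smult_iff[OF A' v(1), of k] v(3) that A by simp
  obtain l where l: "l < n" "v $ l \<noteq> 0"
    using v(1,2) by (metis eq_vecI carrier_vecD index_zero_vec)
  define N where "N = (\<Sum>i<n. (cmod (v $ i))\<^sup>2)"
  have "N > 0"
    unfolding N_def using l by (intro sum_pos2[of _ l]) auto
  have "complex_of_real N = (\<Sum>i<n. v $ i * cnj (v $ i))"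
    unfolding N_def of_real_sum complex_norm_square ..
  then have "k * of_real N = (\<Sum>i<n. cnj (v $ i) * (k * v $ i))"
    by (simp add: sum_distrib_left mult_ac)
  also have "\<dots> = (\<Sum>i<n. \<Sum>j<n. of_real (A $$ (i, j)) * (cnj (v $ i) * v $ j))"
    by (intro sum.cong refl) (simp add: ev[symmetric] sum_distrib_left mult_ac)
  finally have 1: "k * of_real N = (\<Sum>i<n. \<Sum>j<n. of_real (A $$ (i, j)) * (cnj (v $ i) * v $ j))" .
  \<comment> \<open>Conjugation exchanges the roles of i and j, which the symmetry of
    \<open>A\<close> undoes.\<close>
  have "cnj (k * of_real N) = (\<Sum>i<n. \<Sum>j<n. of_real (A $$ (i, j)) * (v $ i * cnj (v $ j)))"
    unfolding 1 by simp
  also have "\<dots> = (\<Sum>j<n. \<Sum>i<n. of_real (A $$ (i, j)) * (v $ i * cnj (v $ j)))"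
    by (rule sum.swap)
  also have "\<dots> = k * of_real N"
    unfolding 1 by (intro sum.cong refl) (simp add: sym mult_ac)
  finally have "cnj k = k" using \<open>N > 0\<close> by simp
  then have "k = of_real (Re k)" by (simp add: complex_eq_iff)
  then obtain \<mu> where \<mu>: "k = of_real \<mu>" by blast
  have "(\<Sum>j<n. A $$ (i, j) * Re (v $ j)) = \<mu> * Re (v $ i)"
    "(\<Sum>j<n. A $$ (i, j) * Im (v $ j)) = \<mu> * Im (v $ i)" if "i < n" for i
    using arg_cong[OF ev[OF that, unfolded \<mu>], of Re] arg_cong[OF ev[OF that, unfolded \<mu>], of Im]
    by simp_all
  moreover have "spectral_radius ?A = \<bar>\<mu>\<bar>"
    unfolding sr \<mu> by simp
  moreover have "Re (v $ l) \<noteq> 0 \<or> Im (v $ l) \<noteq> 0"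
    using l by (simp add: complex_eq_iff)
  ultimately show ?thesis
    using that[of \<mu> "\<lambda>i. Re (v $ i)"] that[of \<mu> "\<lambda>i. Im (v $ i)"] l by blast
qed

text \<open>A real eigenpair stays one over the complex numbers. This gives the lower bound for an
  explicit eigenvector in the extremal case.\<close>

lemma abs_eigenvalue_le_spectral_radius:
  fixes A :: "real mat"
  assumes A: "A \<in> carrier_mat n n" and x: "l < n" "x l \<noteq> 0"
    and ev: "\<And>i. i < n \<Longrightarrow> (\<Sum>j<n. A $$ (i, j) * x j) = \<mu> * x i"
  shows "\<bar>\<mu>\<bar> \<le> spectral_radius (map_mat complex_of_real A)"
proof -
  have "A *\<^sub>v vec n x = \<mu> \<cdot>\<^sub>v vec n x"
    using ev by (subst mult_mat_vec_eq_smult_iff[OF A]) auto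
  moreover have "vec n x \<noteq> 0\<^sub>v n"
    using x by (metis index_vec index_zero_vec(1))
  ultimately have "eigenvalue A \<mu>"
    using A unfolding eigenvalue_def eigenvector_def by (intro exI[of _ "vec n x"]) auto
  then have "eigenvalue (map_mat complex_of_real A) (of_real \<mu>)"
    by (rule of_real_hom.eigenvalue_hom[OF A])
  then have "cmod (of_real \<mu>) \<in> norm ` spectrum (map_mat complex_of_real A)"
    by (intro imageI) (simp add: spectrum_def)
  then have "cmod (of_real \<mu>) \<le> spectral_radius (map_mat complex_of_real A)"
    using A x by (intro spectral_radius_mem_max(2)) auto
  then show ?thesis by simp
qed

section \<open>Edges, cliques and complete multipartite graphs\<close>

lemma edgeE:
  assumes "simple_graph n E" "e \<in> E"
  obtains u v where "e = {u, v}" "u \<noteq> v" "u < n" "v < n"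
proof -
  have "card e = 2" "e \<subseteq> {..<n}" using assms by (auto simp: simple_graph_def nsets_def)
  then show ?thesis using that by (auto simp: card_2_iff)
qed

text \<open>Each edge has two distinct ends, hence exactly two preimages under (i, j) \<mapsto> {i,
  j}. This absorbs the factor 2 of the bound into a double sum comparable with quadratic
  forms.\<close>

lemma sum_ordered_pairs_eq_sum_edges:
  fixes h :: "nat set \<Rightarrow> real"
  assumes "simple_graph n E"
  shows "(\<Sum>i<n. \<Sum>j<n. if {i, j} \<in> E then h {i, j} else 0) = 2 * (\<Sum>e\<in>E. h e)"
proof -
  have E: "E \<subseteq> nsets {..<n} 2" using assms by (simp add: simple_graph_def)
  then have finE: "finite E" by (rule finite_subset) (simp add: finite_imp_finite_nsets)
  let ?P = "{p \<in> {..<n} \<times> {..<n}. {fst p, snd p} \<in> E}" and ?f = "\<lambda>p. {fst p, snd p}"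
  have fibre: "(\<Sum>p | p \<in> ?P \<and> ?f p = e. h (?f p)) = 2 * h e" if "e \<in> E" for e
  proof -
    obtain u v where uv: "e = {u, v}" "u \<noteq> v" "u < n" "v < n"
      using edgeE[OF assms \<open>e \<in> E\<close>] by blast
    have "{p. p \<in> ?P \<and> ?f p = e} = {(u, v), (v, u)}"
      using uv that by (auto simp: doubleton_eq_iff insert_commute)
    then show ?thesis using uv by (simp add: insert_commute)
  qed
  have "(\<Sum>i<n. \<Sum>j<n. if {i, j} \<in> E then h {i, j} else 0)
    = (\<Sum>p\<in>{..<n} \<times> {..<n}. if {fst p, snd p} \<in> E then h {fst p, snd p} else 0)"
    by (simp add: sum.cartesian_product case_prod_beta)
  also have "\<dots> = (\<Sum>p\<in>?P. h (?f p))"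
    by (rule sum.inter_filter[symmetric]) simp
  also have "\<dots> = (\<Sum>e\<in>E. \<Sum>p | p \<in> ?P \<and> ?f p = e. h (?f p))"
    using finE by (intro sum.group[symmetric]) auto
  also have "\<dots> = (\<Sum>e\<in>E. 2 * h e)"
    by (intro sum.cong refl fibre)
  finally show ?thesis by (simp add: sum_distrib_left)
qed

lemma card_clique_le_cl:
  assumes "C \<subseteq> {..<n}" "clique C E" "e \<subseteq> C"
  shows "card C \<le> cl n E e"
proof -
  have "{card C | C. C \<subseteq> {..<n} \<and> clique C E \<and> e \<subseteq> C} \<subseteq> card ` Pow {..<n}" by blast
  then have "finite {card C | C. C \<subseteq> {..<n} \<and> clique C E \<and> e \<subseteq> C}"
    by (rule finite_subset) simp
  then show ?thesis unfolding cl_def using assms by (intro Max_ge) auto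
qed

text \<open>The edge itself is a clique. This keeps the denominators cl - 1 positive on
  edges.\<close>

lemma two_le_cl:
  assumes "simple_graph n E" "e \<in> E"
  shows "2 \<le> cl n E e"
proof -
  obtain u v where uv: "e = {u, v}" "u \<noteq> v" "u < n" "v < n"
    using assms by (rule edgeE)
  then have "clique e E" using assms by (auto simp: clique_def insert_commute)
  then have "card e \<le> cl n E e" using uv by (intro card_clique_le_cl) auto
  then show ?thesis using uv by simp
qed

lemma complete_multipartite_part_unique:
  assumes "complete_multipartite X E r V" "k < r" "l < r" "u \<in> V k" "u \<in> V l"
  shows "k = l"
  using assms by (auto simp: complete_multipartite_def disjoint_family_on_def)

text \<open>Edges are given through some representatives; disjointness makes the part indices of
  \<open>u\<close> and \<open>v\<close> unambiguous.\<close>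

lemma complete_multipartite_edge_iff:
  assumes "complete_multipartite X E r V" "i < r" "j < r" "u \<in> V i" "v \<in> V j"
  shows "{u, v} \<in> E \<longleftrightarrow> i \<noteq> j"
proof -
  note uniq = complete_multipartite_part_unique[OF assms(1)]
  have E: "E = {{u, v} | u v. \<exists>i<r. \<exists>j<r. i \<noteq> j \<and> u \<in> V i \<and> v \<in> V j}"
    using assms(1) by (simp add: complete_multipartite_def)
  show ?thesis
  proof
    assume "{u, v} \<in> E"
    then obtain a b k l where kl: "{u, v} = {a, b}" "k < r" "l < r" "k \<noteq> l" "a \<in> V k" "b \<in> V l"
      unfolding E by blast
    from kl(1) consider "u = a" "v = b" | "u = b" "v = a" by (auto simp: doubleton_eq_iff)
    then show "i \<noteq> j"
      using kl uniq[OF assms(2) _ assms(4)] uniq[OF assms(3) _ assms(5)] by cases metis+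
  next
    assume "i \<noteq> j"
    then show "{u, v} \<in> E" unfolding E using assms by blast
  qed
qed

text \<open>One vertex from each part gives a clique, and a clique meets each part at most
  once.\<close>

lemma cl_complete_multipartite:
  assumes mp: "complete_multipartite X E r V" and X: "X \<subseteq> {..<n}"
    and isol: "\<forall>v \<in> {..<n} - X. \<forall>e\<in>E. v \<notin> e" and e: "e \<in> E"
  shows "cl n E e = r"
proof (rule antisym)
  obtain u v i j where uv: "e = {u, v}" "i < r" "j < r" "i \<noteq> j" "u \<in> V i" "v \<in> V j"
    using mp e by (auto simp: complete_multipartite_def)
  have XV: "X = (\<Union>i<r. V i)" and ne: "V k \<noteq> {}" if "k < r" for k
    using mp that by (auto simp: complete_multipartite_def)
  \<comment> \<open>A transversal of the parts that is forced through both ends of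
    \<open>e\<close>.\<close>
  define f where "f = (\<lambda>k. if k = i then u else if k = j then v else (SOME x. x \<in> V k))"
  have f: "f k \<in> V k" if "k < r" for k
    using uv ne[OF that] by (auto simp: f_def some_in_eq)
  have edge: "{f k, f l} \<in> E \<longleftrightarrow> k \<noteq> l" if "k < r" "l < r" for k l
    using complete_multipartite_edge_iff[OF mp that f f] that by simp
  have "inj_on f {..<r}"
    by (intro inj_onI) (metis edge lessThan_iff)
  then have "card (f ` {..<r}) = r" by (simp add: card_image)
  moreover have "clique (f ` {..<r}) E"
    using edge by (auto simp: clique_def)
  moreover have "e \<subseteq> f ` {..<r}"
    using uv by (auto simp: f_def image_iff intro!: bexI[of _ i] bexI[of _ j])
  moreover have "f ` {..<r} \<subseteq> {..<n}"
    using f X XV uv by blast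
  ultimately show "r \<le> cl n E e"
    using card_clique_le_cl by metis
  have "card C \<le> r" if C: "C \<subseteq> {..<n}" "clique C E" "e \<subseteq> C" for C
  proof -
    have "\<exists>k<r. w \<in> V k" if "w \<in> C" for w
    proof -
      \<comment> \<open>As \<open>C\<close> contains the edge \<open>e\<close>, each of its vertices
        is an end of some edge, so isolated vertices outside \<open>X\<close> cannot occur.\<close>
      have "w \<in> e \<or> {w, u} \<in> E" using C that uv by (auto simp: clique_def)
      then have "\<exists>e\<in>E. w \<in> e" using e by blast
      then have "w \<in> X" using isol C that by blast
      then show ?thesis using XV uv by blast
    qed
    then obtain p where p: "\<And>w. w \<in> C \<Longrightarrow> p w < r \<and> w \<in> V (p w)" by metis
    have "inj_on p C"
    proof (rule inj_onI, rule ccontr)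
      fix w w' assume w: "w \<in> C" "w' \<in> C" "p w = p w'" "w \<noteq> w'"
      then have "{w, w'} \<in> E" using C by (auto simp: clique_def)
      then show False
        using complete_multipartite_edge_iff[OF mp, of "p w" "p w'" w w'] p[OF w(1)] p[OF w(2)] w(3) by simp
    qed
    then have "card C \<le> card {..<r}"
      using p by (intro card_inj_on_le[of p]) auto
    then show ?thesis by simp
  qed
  moreover have "finite {card C | C. C \<subseteq> {..<n} \<and> clique C E \<and> e \<subseteq> C}"
    by (rule finite_subset[of _ "card ` Pow {..<n}"]) auto
  \<comment> \<open>\<open>e\<close> itself shows that the set under \<open>Max\<close> is
    nonempty.\<close>
  moreover have "clique e E" "e \<subseteq> {..<n}"
    using e uv X XV by (auto simp: clique_def insert_commute)
  ultimately show "cl n E e \<le> r"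
    unfolding cl_def by (subst Max_le_iff) auto
qed

section \<open>Edge coefficients and the bound\<close>

text \<open>On edges this is the reciprocal of the factor in the bound, the pairing that weighted
  Cauchy-Schwarz requires.\<close>

definition edge_coeff :: "nat \<Rightarrow> nat set set \<Rightarrow> nat \<Rightarrow> nat \<Rightarrow> real" where
  "edge_coeff n E u v
    = (if {u, v} \<in> E then real (cl n E {u, v}) / (real (cl n E {u, v}) - 1) else 0)"

lemma edge_coeff_sym: "edge_coeff n E u v = edge_coeff n E v u"
  by (simp add: edge_coeff_def insert_commute)

lemma edge_coeff_diag: "simple_graph n E \<Longrightarrow> edge_coeff n E u u = 0"
  by (auto simp: edge_coeff_def simple_graph_def nsets_def)

lemma edge_coeff_pos:
  assumes "simple_graph n E" "{u, v} \<in> E"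
  shows "edge_coeff n E u v > 0"
  using two_le_cl[OF assms] assms(2) by (simp add: edge_coeff_def)

text \<open>Nonzero coefficients make \<open>S\<close> a clique, so \<open>card S\<close> is at most
  the clique number of each edge in it, and k/(k - 1) decreases for k \<ge> 2.\<close>

lemma edge_coeff_le_clique:
  assumes "S \<subseteq> {..<n}" "\<forall>p\<in>S. \<forall>q\<in>S. p \<noteq> q \<longrightarrow> edge_coeff n E p q \<noteq> 0"
    and uv: "u \<in> S" "v \<in> S" "u \<noteq> v"
  shows "edge_coeff n E u v \<le> real (card S) / (real (card S) - 1)"
proof -
  have cliq: "clique S E"
    using assms(2) by (auto simp: clique_def edge_coeff_def split: if_splits)
  then have "{u, v} \<in> E" using uv by (auto simp: clique_def)
  have "card {u, v} \<le> card S"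
    using assms(1) uv by (intro card_mono) (auto intro: finite_subset)
  then have 1: "2 \<le> card S" using uv by simp
  have 2: "card S \<le> cl n E {u, v}"
    using assms(1) cliq uv by (intro card_clique_le_cl) auto
  show ?thesis
    using 1 2 \<open>{u, v} \<in> E\<close> by (simp add: edge_coeff_def field_simps)
qed

lemma quad_form_edge_coeff_le:
  assumes "simple_graph n E" "\<And>u. u \<in> {..<n} \<Longrightarrow> 0 \<le> y u"
  shows "quad_form {..<n} (edge_coeff n E) y \<le> (\<Sum>u<n. y u)\<^sup>2"
  using assms
  by (intro localized_motzkin_straus edge_coeff_sym edge_coeff_diag edge_coeff_le_clique) auto

definition spectral_bound :: "nat \<Rightarrow> nat set set \<Rightarrow> (nat set \<Rightarrow> real) \<Rightarrow> real" where
  "spectral_bound n E w = sqrt (2 * (\<Sum>e\<in>E. (real (cl n E e) - 1) / real (cl n E e) * (w e)\<^sup>2))"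

lemma spectral_bound_nonneg: "spectral_bound n E w \<ge> 0"
  and spectral_bound_squared: "simple_graph n E \<Longrightarrow> (spectral_bound n E w)\<^sup>2
    = (\<Sum>i<n. \<Sum>j<n. if {i, j} \<in> E then (w {i, j})\<^sup>2 / edge_coeff n E i j else 0)"
proof -
  \<comment> \<open>This covers arbitrary \<open>e\<close>: if \<open>cl n E e\<close> is 0, the
    quotient is 0 by the convention on division by zero.\<close>
  have "0 \<le> (real (cl n E e) - 1) / real (cl n E e)" for e
    by (cases "cl n E e") auto
  then have nn: "0 \<le> 2 * (\<Sum>e\<in>E. (real (cl n E e) - 1) / real (cl n E e) * (w e)\<^sup>2)"
    by (intro mult_nonneg_nonneg sum_nonneg) simp_all
  then show "spectral_bound n E w \<ge> 0" by (simp add: spectral_bound_def)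
  assume G: "simple_graph n E"
  have "(spectral_bound n E w)\<^sup>2 = 2 * (\<Sum>e\<in>E. (real (cl n E e) - 1) / real (cl n E e) * (w e)\<^sup>2)"
    using nn by (simp add: spectral_bound_def)
  then show "(spectral_bound n E w)\<^sup>2
    = (\<Sum>i<n. \<Sum>j<n. if {i, j} \<in> E then (w {i, j})\<^sup>2 / edge_coeff n E i j else 0)"
    unfolding sum_ordered_pairs_eq_sum_edges[OF G, symmetric]
    by (auto simp: edge_coeff_def mult.commute intro!: sum.cong)
qed

section \<open>Weighted Cauchy-Schwarz and the upper bound\<close>

lemma adj_mat_carrier: "adj_mat n E w \<in> carrier_mat n n"
  by (simp add: adj_mat_def)

lemma adj_mat_index:
  "i < n \<Longrightarrow> j < n \<Longrightarrow> adj_mat n E w $$ (i, j) = (if {i, j} \<in> E then w {i, j} else 0)"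
  by (simp add: adj_mat_def)

text \<open>Weighted Cauchy-Schwarz: the defect between the two sides is written as a sum of squares,
  so that equality forces every square to vanish.\<close>

lemma sum_squares_defect:
  assumes G: "simple_graph n E"
    and ev: "\<And>i. i < n \<Longrightarrow> (\<Sum>j<n. adj_mat n E w $$ (i, j) * x j) = \<mu> * x i"
  defines "T \<equiv> \<Sum>i<n. (x i)\<^sup>2"
  shows "(\<Sum>i<n. \<Sum>j<n. if {i, j} \<in> E
      then (T * w {i, j} - \<beta> * edge_coeff n E i j * x i * x j)\<^sup>2 / edge_coeff n E i j else 0)
    = T\<^sup>2 * (spectral_bound n E w)\<^sup>2 - 2 * T\<^sup>2 * (\<beta> * \<mu>)
      + \<beta>\<^sup>2 * quad_form {..<n} (edge_coeff n E) (\<lambda>i. (x i)\<^sup>2)"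
proof -
  let ?A = "\<lambda>i j. adj_mat n E w $$ (i, j)" and ?b = "edge_coeff n E"
  have "(\<Sum>i<n. x i * (\<Sum>j<n. ?A i j * x j)) = (\<Sum>i<n. \<mu> * (x i)\<^sup>2)"
    by (intro sum.cong refl) (simp add: ev power2_eq_square)
  then have \<mu>: "(\<Sum>i<n. \<Sum>j<n. x i * (?A i j * x j)) = \<mu> * T"
    by (simp add: T_def sum_distrib_left)
  \<comment> \<open>Dividing the expanded square by the coefficient leaves one term for the bound,
    one for the Rayleigh form of the matrix and one for \<open>quad_form\<close>.\<close>
  have "(if {i, j} \<in> E then (T * w {i, j} - \<beta> * ?b i j * x i * x j)\<^sup>2 / ?b i j else 0)
    = T\<^sup>2 * (if {i, j} \<in> E then (w {i, j})\<^sup>2 / ?b i j else 0)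
      - 2 * T * \<beta> * (x i * (?A i j * x j)) + \<beta>\<^sup>2 * ((x i)\<^sup>2 * ((x j)\<^sup>2 * ?b i j))"
    if "i < n" "j < n" for i j
  proof (cases "{i, j} \<in> E")
    case True
    then show ?thesis
      using edge_coeff_pos[OF G True] that
      by (simp add: adj_mat_index field_simps power2_eq_square)
  next
    case False
    then show ?thesis using that by (simp add: adj_mat_index edge_coeff_def)
  qed
  then have "(\<Sum>i<n. \<Sum>j<n. if {i, j} \<in> E
      then (T * w {i, j} - \<beta> * ?b i j * x i * x j)\<^sup>2 / ?b i j else 0)
    = (\<Sum>i<n. \<Sum>j<n. T\<^sup>2 * (if {i, j} \<in> E then (w {i, j})\<^sup>2 / ?b i j else 0)
      - 2 * T * \<beta> * (x i * (?A i j * x j)) + \<beta>\<^sup>2 * ((x i)\<^sup>2 * ((x j)\<^sup>2 * ?b i j)))"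
    by (intro sum.cong refl) simp
  also have "\<dots> = T\<^sup>2 * (spectral_bound n E w)\<^sup>2 - 2 * T * \<beta> * (\<mu> * T)
      + \<beta>\<^sup>2 * quad_form {..<n} ?b (\<lambda>i. (x i)\<^sup>2)"
    unfolding spectral_bound_squared[OF G] \<mu>[symmetric] quad_form_def
    by (simp add: sum.distrib sum_subtractf sum_distrib_left)
  finally show ?thesis by (simp add: power2_eq_square mult_ac)
qed

lemma graph_spectral_radius_eigenvector:
  assumes "n \<ge> 1"
  obtains \<mu> x where "graph_spectral_radius n E w = \<bar>\<mu>\<bar>" and "\<exists>i<n. x i \<noteq> 0"
    and "\<And>i. i < n \<Longrightarrow> (\<Sum>j<n. adj_mat n E w $$ (i, j) * x j) = \<mu> * x i"
proof -
  have "adj_mat n E w $$ (i, j) = adj_mat n E w $$ (j, i)" if "i < n" "j < n" for i j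
    using that by (simp add: adj_mat_index insert_commute)
  then show ?thesis
    using spectral_radius_symmetric_eigenvector[OF adj_mat_carrier, of n E w] assms that
    unfolding graph_spectral_radius_def by auto
qed

text \<open>Isolates the degenerate case: when the bound is 0, the choice of \<open>\<beta>\<close>
  below removes \<open>\<mu>\<close> from the defect identity.\<close>

lemma spectral_bound_eq_0_iff:
  assumes G: "simple_graph n E"
  shows "spectral_bound n E w = 0 \<longleftrightarrow> (\<forall>e\<in>E. w e = 0)"
proof -
  have E: "E \<subseteq> nsets {..<n} 2" using G by (simp add: simple_graph_def)
  then have "finite E" by (rule finite_subset) (simp add: finite_imp_finite_nsets)
  moreover have "0 \<le> (real (cl n E e) - 1) / real (cl n E e)" for e
    by (cases "cl n E e") auto
  ultimately have "(\<Sum>e\<in>E. (real (cl n E e) - 1) / real (cl n E e) * (w e)\<^sup>2) = 0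
      \<longleftrightarrow> (\<forall>e\<in>E. (real (cl n E e) - 1) / real (cl n E e) * (w e)\<^sup>2 = 0)"
    by (intro sum_nonneg_eq_0_iff mult_nonneg_nonneg) simp_all
  then have "spectral_bound n E w = 0
      \<longleftrightarrow> (\<forall>e\<in>E. (real (cl n E e) - 1) / real (cl n E e) * (w e)\<^sup>2 = 0)"
    unfolding spectral_bound_def by (simp del: times_divide_eq_left)
  also have "\<dots> \<longleftrightarrow> (\<forall>e\<in>E. w e = 0)"
    using two_le_cl[OF G] by fastforce
  finally show ?thesis .
qed

text \<open>The defect T^2 * B^2 - 2 * T^2 * B * \<bar>\<mu>\<bar> + B^2 * Q is nonnegative and Q
  \<le> T^2, whence \<bar>\<mu>\<bar> \<le> B if B > 0. If equality holds, all squares in the defect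
  vanish, which determines the weights from the eigenvector.\<close>

lemma
  assumes n: "n \<ge> 1" and G: "simple_graph n E"
  shows graph_spectral_radius_le: "graph_spectral_radius n E w \<le> spectral_bound n E w"
    and graph_spectral_radius_eq_boundD: "graph_spectral_radius n E w = spectral_bound n E w
      \<Longrightarrow> \<exists>e\<in>E. w e \<noteq> 0
      \<Longrightarrow> \<exists>\<beta> x. (\<exists>i<n. x i \<noteq> 0)
        \<and> quad_form {..<n} (edge_coeff n E) (\<lambda>i. (x i)\<^sup>2) = (\<Sum>i<n. (x i)\<^sup>2)\<^sup>2
        \<and> (\<forall>i<n. \<forall>j<n. {i, j} \<in> E \<longrightarrow> w {i, j} = \<beta> * edge_coeff n E i j * x i * x j)"
proof -
  obtain \<mu> x where sr: "graph_spectral_radius n E w = \<bar>\<mu>\<bar>" and x: "\<exists>i<n. x i \<noteq> 0"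
    and ev: "\<And>i. i < n \<Longrightarrow> (\<Sum>j<n. adj_mat n E w $$ (i, j) * x j) = \<mu> * x i"
    using graph_spectral_radius_eigenvector[OF n] by blast
  define T where "T = (\<Sum>i<n. (x i)\<^sup>2)"
  define B where "B = spectral_bound n E w"
  \<comment> \<open>The sign follows \<open>\<mu>\<close>, so that \<open>\<beta> * \<mu>\<close>
    equals \<open>B * \<bar>\<mu>\<bar>\<close>.\<close>
  define \<beta> where "\<beta> = (if \<mu> \<ge> 0 then B else - B)"
  define Q where "Q = quad_form {..<n} (edge_coeff n E) (\<lambda>i. (x i)\<^sup>2)"
  define D where "D = (\<lambda>i j. if {i, j} \<in> E
      then (T * w {i, j} - \<beta> * edge_coeff n E i j * x i * x j)\<^sup>2 / edge_coeff n E i j else 0)"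
  have T: "T > 0" unfolding T_def using x by (auto intro: sum_pos2)
  have Q: "Q \<le> T\<^sup>2" unfolding Q_def T_def using G by (rule quad_form_edge_coeff_le) simp
  have D: "D i j \<ge> 0" for i j
    using edge_coeff_pos[OF G, of i j] by (auto simp: D_def)
  have \<beta>: "\<beta>\<^sup>2 = B\<^sup>2" "\<beta> * \<mu> = B * \<bar>\<mu>\<bar>" by (auto simp: \<beta>_def)
  have sumD: "(\<Sum>i<n. \<Sum>j<n. D i j) = T\<^sup>2 * B\<^sup>2 - 2 * T\<^sup>2 * (B * \<bar>\<mu>\<bar>) + B\<^sup>2 * Q"
    using sum_squares_defect[OF G ev, of \<beta>] \<beta>
    unfolding D_def T_def Q_def B_def by simp
  have D0: "(\<Sum>i<n. \<Sum>j<n. D i j) \<ge> 0" by (intro sum_nonneg D)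
  show "graph_spectral_radius n E w \<le> spectral_bound n E w"
  proof (cases "B = 0")
    case True
    then have "\<forall>e\<in>E. w e = 0" using spectral_bound_eq_0_iff[OF G] by (simp add: B_def)
    then have "\<mu> * x i = 0" if "i < n" for i
      using ev[OF that, symmetric] that by (auto simp: adj_mat_index intro!: sum.neutral)
    then have "\<mu> = 0" using x by auto
    then show ?thesis using sr spectral_bound_nonneg[of n E w] by simp
  next
    case False
    then have B: "B > 0" using spectral_bound_nonneg[of n E w] by (simp add: B_def)
    have "B\<^sup>2 * Q \<le> B\<^sup>2 * T\<^sup>2" using Q by (intro mult_left_mono) auto
    then have "0 \<le> (2 * T\<^sup>2 * B) * (B - \<bar>\<mu>\<bar>)"
      using sumD D0 by (simp add: algebra_simps power2_eq_square)
    moreover have "2 * T\<^sup>2 * B > 0" using B T by simp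
    ultimately have "0 \<le> B - \<bar>\<mu>\<bar>"
      by (metis zero_le_mult_iff not_le)
    then show ?thesis using sr by (simp add: B_def)
  qed
  assume eq: "graph_spectral_radius n E w = spectral_bound n E w" and "\<exists>e\<in>E. w e \<noteq> 0"
  then have B: "B > 0"
    using spectral_bound_eq_0_iff[OF G, of w] spectral_bound_nonneg[of n E w] by (auto simp: B_def)
  \<comment> \<open>The left side is nonnegative and the right side nonpositive, so both are
    0.\<close>
  have "(\<Sum>i<n. \<Sum>j<n. D i j) = B\<^sup>2 * (Q - T\<^sup>2)"
    using sumD eq sr by (simp add: B_def algebra_simps power2_eq_square)
  moreover from this D0 B have "Q = T\<^sup>2"
    using Q by (simp add: zero_le_mult_iff)
  ultimately have "(\<Sum>i<n. \<Sum>j<n. D i j) = 0" by simp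
  then have Dz: "D i j = 0" if "i < n" "j < n" for i j
    using that D by (simp add: sum_nonneg_eq_0_iff sum_nonneg)
  have "w {i, j} = (\<beta> / T) * edge_coeff n E i j * x i * x j" if "i < n" "j < n" "{i, j} \<in> E" for i j
    using Dz[OF that(1,2)] that T edge_coeff_pos[OF G that(3)] by (simp add: D_def field_simps)
  then show "\<exists>\<beta> x. (\<exists>i<n. x i \<noteq> 0)
      \<and> quad_form {..<n} (edge_coeff n E) (\<lambda>i. (x i)\<^sup>2) = (\<Sum>i<n. (x i)\<^sup>2)\<^sup>2
      \<and> (\<forall>i<n. \<forall>j<n. {i, j} \<in> E \<longrightarrow> w {i, j} = \<beta> * edge_coeff n E i j * x i * x j)"
    using x \<open>Q = T\<^sup>2\<close> unfolding Q_def T_def by blast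
qed

section \<open>Sums over parts and entries of the extremal matrix\<close>

text \<open>The neighbours of \<open>i\<close> are the vertices of \<open>X\<close> outside its own
  part, and \<open>g\<close> vanishes off \<open>X\<close>.\<close>

lemma complete_multipartite_neighbour_sum:
  fixes g :: "nat \<Rightarrow> real"
  assumes mp: "complete_multipartite X E r V" and X: "X \<subseteq> {..<n}"
    and g: "\<And>j. j < n \<Longrightarrow> j \<notin> X \<Longrightarrow> g j = 0" and k: "k < r" "i \<in> V k"
  shows "(\<Sum>j<n. if {i, j} \<in> E then g j else 0) = (\<Sum>j<n. g j) - (\<Sum>j\<in>V k. g j)"
proof -
  have XV: "X = (\<Union>i<r. V i)" using mp by (auto simp: complete_multipartite_def)
  have "(if {i, j} \<in> E then g j else 0) = g j - (if j \<in> V k then g j else 0)" if "j < n" for j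
  proof (cases "j \<in> X")
    case True
    then obtain l where l: "l < r" "j \<in> V l" using XV by auto
    have "j \<in> V k \<longleftrightarrow> k = l"
      using complete_multipartite_part_unique[OF mp k(1) l(1) _ l(2)] l(2) by blast
    then show ?thesis
      using complete_multipartite_edge_iff[OF mp k(1) l(1) k(2) l(2)] by simp
  qed (use g that in auto)
  then have "(\<Sum>j<n. if {i, j} \<in> E then g j else 0)
      = (\<Sum>j<n. g j) - (\<Sum>j<n. if j \<in> V k then g j else 0)"
    by (simp add: sum_subtractf[symmetric])
  also have "(\<Sum>j<n. if j \<in> V k then g j else 0) = (\<Sum>j\<in>{..<n} \<inter> V k. g j)"
    by (simp add: sum.inter_restrict)
  also have "{..<n} \<inter> V k = V k" using X XV k by blast
  finally show ?thesis .
qed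

lemma complete_multipartite_sum_parts:
  fixes g :: "nat \<Rightarrow> real"
  assumes mp: "complete_multipartite X E r V" and X: "X \<subseteq> {..<n}"
    and g: "\<And>j. j < n \<Longrightarrow> j \<notin> X \<Longrightarrow> g j = 0"
  shows "(\<Sum>k<r. \<Sum>j\<in>V k. g j) = (\<Sum>j<n. g j)"
proof -
  have XV: "X = (\<Union>i<r. V i)" "disjoint_family_on V {..<r}"
    using mp by (auto simp: complete_multipartite_def)
  have "(\<Sum>j<n. g j) = (\<Sum>j\<in>X. g j)"
    using X g by (intro sum.mono_neutral_right) auto
  also have "\<dots> = (\<Sum>k<r. \<Sum>j\<in>V k. g j)"
    unfolding XV(1)
  proof (rule sum.UNION_disjoint)
    show "\<forall>i\<in>{..<r}. finite (V i)"
      using XV(1) X by (metis SUP_upper finite_lessThan finite_subset)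
  qed (use XV in \<open>auto simp: disjoint_family_on_def\<close>)
  finally show ?thesis by simp
qed

text \<open>At most one summand survives, as \<open>i\<close> lies in at most one part. A vertex
  \<open>j\<close> outside \<open>X\<close> also satisfies \<open>j \<notin> V k\<close>, so the
  entry need not respect adjacency until \<open>x\<close> is known to vanish off
  \<open>X\<close>.\<close>

lemma sum_of_outer_prods_index:
  assumes mp: "complete_multipartite X E r V" and x: "x \<in> carrier_vec n" and ij: "i < n" "j < n"
  shows "sum_of_mats n (\<lambda>k. outer_prod (hadamard_vec (char_vec n (V k)) x)
      (hadamard_vec (ones_vec n - char_vec n (V k)) x)) {..<r} $$ (i, j)
    = (if \<exists>k<r. i \<in> V k \<and> j \<notin> V k then x $ i * x $ j else 0)"
proof -
  have eq: "sum_of_mats n (\<lambda>k. outer_prod (hadamard_vec (char_vec n (V k)) x)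
      (hadamard_vec (ones_vec n - char_vec n (V k)) x)) {..<r} $$ (i, j)
    = (\<Sum>k<r. if i \<in> V k \<and> j \<notin> V k then x $ i * x $ j else 0)"
    using ij x by (auto simp: sum_of_mats_def outer_prod_def hadamard_vec_def char_vec_def
        ones_vec_def intro!: sum.cong)
  show ?thesis
  proof (cases "\<exists>k<r. i \<in> V k \<and> j \<notin> V k")
    case True
    then obtain k where k: "k < r" "i \<in> V k" "j \<notin> V k" by blast
    have "i \<notin> V l" if "l < r" "l \<noteq> k" for l
      using complete_multipartite_part_unique[OF mp k(1) _ k(2)] that by blast
    then have "(\<Sum>k<r. if i \<in> V k \<and> j \<notin> V k then x $ i * x $ j else 0)
        = (\<Sum>l<r. if l = k then x $ i * x $ j else 0)"
      using k by (intro sum.cong) auto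
    then show ?thesis using True k eq by simp
  next
    case False
    then show ?thesis unfolding eq by (subst if_not_P) (auto intro!: sum.neutral)
  qed
qed

lemma sum_of_outer_prods_index_supported:
  assumes mp: "complete_multipartite X E r V" and x: "x \<in> carrier_vec n" and ij: "i < n" "j < n"
    and supp: "\<And>i. i < n \<Longrightarrow> i \<notin> X \<Longrightarrow> x $ i = 0"
  shows "sum_of_mats n (\<lambda>k. outer_prod (hadamard_vec (char_vec n (V k)) x)
      (hadamard_vec (ones_vec n - char_vec n (V k)) x)) {..<r} $$ (i, j)
    = (if {i, j} \<in> E then x $ i * x $ j else 0)"
proof (cases "i \<in> X \<and> j \<in> X")
  case True
  then obtain k l where kl: "k < r" "l < r" "i \<in> V k" "j \<in> V l"
    using mp by (auto simp: complete_multipartite_def)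
  have "k' = k" if "k' < r" "i \<in> V k'" for k'
    using complete_multipartite_part_unique[OF mp that(1) kl(1) that(2) kl(3)] .
  moreover have "j \<in> V k \<longleftrightarrow> k = l"
    using complete_multipartite_part_unique[OF mp kl(1,2) _ kl(4)] kl(4) by blast
  ultimately have "(\<exists>k<r. i \<in> V k \<and> j \<notin> V k) \<longleftrightarrow> {i, j} \<in> E"
    using complete_multipartite_edge_iff[OF mp kl] kl by metis
  then show ?thesis
    unfolding sum_of_outer_prods_index[OF mp x ij] by simp
next
  case False
  then have "x $ i * x $ j = 0" using supp ij by auto
  then show ?thesis
    unfolding sum_of_outer_prods_index[OF mp x ij] by simp
qed

lemma euclidean_norm_squared:
  "x \<in> carrier_vec n \<Longrightarrow> (euclidean_norm x)\<^sup>2 = (\<Sum>i<n. (x $ i)\<^sup>2)"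
  unfolding euclidean_norm_def by (simp add: sum_nonneg)

lemma euclidean_norm_restrict_squared:
  assumes "x \<in> carrier_vec n" "S \<subseteq> {..<n}"
  shows "(euclidean_norm (hadamard_vec (char_vec n S) x))\<^sup>2 = (\<Sum>i\<in>S. (x $ i)\<^sup>2)"
proof -
  have "(euclidean_norm (hadamard_vec (char_vec n S) x))\<^sup>2
      = (\<Sum>i<n. (hadamard_vec (char_vec n S) x $ i)\<^sup>2)"
    by (rule euclidean_norm_squared) (simp add: hadamard_vec_def char_vec_def)
  also have "\<dots> = (\<Sum>i<n. if i \<in> S then (x $ i)\<^sup>2 else 0)"
    by (intro sum.cong) (auto simp: hadamard_vec_def char_vec_def)
  also have "\<dots> = (\<Sum>i\<in>{..<n} \<inter> S. (x $ i)\<^sup>2)"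
    by (simp add: sum.inter_restrict)
  also have "{..<n} \<inter> S = S" using assms by blast
  finally show ?thesis .
qed

text \<open>Abbreviates the literal matrix expression of \<open>extremal_structure\<close>, so that
  it matches after unfolding.\<close>

abbreviation (input) part_product_sum :: "nat \<Rightarrow> (nat \<Rightarrow> nat set) \<Rightarrow> nat \<Rightarrow> real vec \<Rightarrow> real mat" where
  "part_product_sum n V r x \<equiv> sum_of_mats n
     (\<lambda>i. outer_prod (hadamard_vec (char_vec n (V i)) x)
                     (hadamard_vec (ones_vec n - char_vec n (V i)) x)) {..<r}"

lemma frobenius_norm_adj_mat_squared:
  "(frobenius_norm (adj_mat n E w))\<^sup>2 = (\<Sum>i<n. \<Sum>j<n. if {i, j} \<in> E then (w {i, j})\<^sup>2 else 0)"
proof -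
  have "(frobenius_norm (adj_mat n E w))\<^sup>2 = (\<Sum>i<n. \<Sum>j<n. (adj_mat n E w $$ (i, j))\<^sup>2)"
    unfolding frobenius_norm_def adj_mat_def by (simp add: sum_nonneg)
  also have "\<dots> = (\<Sum>i<n. \<Sum>j<n. if {i, j} \<in> E then (w {i, j})\<^sup>2 else 0)"
    by (intro sum.cong refl) (auto simp: adj_mat_index)
  finally show ?thesis .
qed

section \<open>Extremal graphs attain the bound\<close>

text \<open>The right-hand side of the norm condition does not depend on the part, so all parts have
  the same squared norm p, and S = r * p is the total. Then \<open>x\<close> is an eigenvector with
  eigenvalue s * (S - p), whose modulus is the bound.\<close>

lemma extremal_structure_imp_bound_le:
  assumes n: "n \<ge> 1" and G: "simple_graph n E" and ext: "extremal_structure n E w"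
  shows "spectral_bound n E w \<le> graph_spectral_radius n E w"
proof (cases "\<forall>e\<in>E. w e = 0")
  case True
  then have "spectral_bound n E w = 0" using spectral_bound_eq_0_iff[OF G] by blast
  then show ?thesis
    using graph_spectral_radius_eigenvector[OF n, of E w] by (metis abs_ge_zero)
next
  case False
  then obtain e0 where e0: "e0 \<in> E" "w e0 \<noteq> 0" by blast
  obtain r V X x s where X: "X \<subseteq> {..<n}" and isol: "\<forall>v \<in> {..<n} - X. \<forall>e\<in>E. v \<notin> e"
    and mp: "complete_multipartite X E r V" and x: "x \<in> carrier_vec n" and s: "s \<in> {1, -1::real}"
    and A: "adj_mat n E w = s \<cdot>\<^sub>m part_product_sum n V r x"
    and parts: "\<forall>i<r. (euclidean_norm (hadamard_vec (char_vec n (V i)) x))\<^sup>2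
                 = (euclidean_norm x)\<^sup>2 - sqrt (1 - 1 / real r) * frobenius_norm (adj_mat n E w)"
    using ext unfolding extremal_structure_def complete_multipartite_up_to_isolated_def by blast
  have XV: "X = (\<Union>i<r. V i)" using mp by (auto simp: complete_multipartite_def)
  then have Vn: "V k \<subseteq> {..<n}" if "k < r" for k using X that by blast
  have A': "adj_mat n E w $$ (i, j) = s * part_product_sum n V r x $$ (i, j)"
    if "i < n" "j < n" for i j
    unfolding A using that by (simp add: sum_of_mats_def)
  obtain u v where uv: "e0 = {u, v}" "u < n" "v < n" using edgeE[OF G e0(1)] by metis
  have u: "u \<in> X" using isol e0 uv by blast
  then obtain k0 where k0: "k0 < r" "u \<in> V k0" using XV by blast
  have xu: "x $ u \<noteq> 0"
    using A'[OF uv(2,3)] e0 uv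
    by (auto simp: sum_of_outer_prods_index[OF mp x uv(2,3)] adj_mat_index split: if_splits)
  \<comment> \<open>The entry at \<open>(u, i)\<close> is x u * x i up to sign, yet it is 0 because
    \<open>i\<close> is isolated; and x u is nonzero.\<close>
  have supp: "x $ i = 0" if i: "i < n" "i \<notin> X" for i
  proof -
    have "i \<notin> V k0" using XV i k0 by blast
    then have "part_product_sum n V r x $$ (u, i) = x $ u * x $ i"
      using sum_of_outer_prods_index[OF mp x uv(2) i(1)] k0 by auto
    moreover have "{u, i} \<notin> E" using isol i by blast
    ultimately show ?thesis using A'[OF uv(2) i(1)] s xu uv i by (auto simp: adj_mat_index)
  qed
  have A'': "adj_mat n E w $$ (i, j) = s * (if {i, j} \<in> E then x $ i * x $ j else 0)"
    if "i < n" "j < n" for i j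
    unfolding A'[OF that] by (subst sum_of_outer_prods_index_supported[OF mp x that]) (simp_all add: supp)
  have w: "w {i, j} = s * (x $ i * x $ j)" if "i < n" "j < n" "{i, j} \<in> E" for i j
    using A''[OF that(1,2)] that by (simp add: adj_mat_index)
  define S where "S = (\<Sum>i<n. (x $ i)\<^sup>2)"
  define p where "p = S - sqrt (1 - 1 / real r) * frobenius_norm (adj_mat n E w)"
  have p: "(\<Sum>j\<in>V k. (x $ j)\<^sup>2) = p" if "k < r" for k
    using parts that euclidean_norm_restrict_squared[OF x Vn[OF that]] euclidean_norm_squared[OF x]
    by (simp add: p_def S_def)
  have "(\<Sum>k<r. \<Sum>j\<in>V k. (x $ j)\<^sup>2) = S"
    unfolding S_def by (rule complete_multipartite_sum_parts[OF mp X]) (simp add: supp)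
  then have S: "S = real r * p" using p by simp
  have p0: "p \<ge> 0" using p[OF k0(1)] by (metis sum_nonneg zero_le_power2)
  have r: "r \<ge> 1" using k0 by simp
  have nb: "(\<Sum>j<n. if {i, j} \<in> E then (x $ j)\<^sup>2 else 0) = S - p" if "k < r" "i \<in> V k" for i k
    unfolding S_def p[OF that(1), symmetric]
    by (rule complete_multipartite_neighbour_sum[OF mp X _ that]) (simp add: supp)
  \<comment> \<open>The factor \<open>x $ i\<close> extends the identity to vertices outside
    \<open>X\<close>, where both sides are 0.\<close>
  have nb': "x $ i * (\<Sum>j<n. if {i, j} \<in> E then (x $ j)\<^sup>2 else 0) = x $ i * (S - p)" if "i < n" for i
    using nb supp[OF that] XV by (cases "i \<in> X") auto
  have "(\<Sum>j<n. adj_mat n E w $$ (i, j) * x $ j) = (s * (S - p)) * x $ i" if i: "i < n" for i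
  proof -
    have "(\<Sum>j<n. adj_mat n E w $$ (i, j) * x $ j)
        = (\<Sum>j<n. s * (x $ i * (if {i, j} \<in> E then (x $ j)\<^sup>2 else 0)))"
      by (intro sum.cong refl) (simp add: A'' i power2_eq_square)
    also have "\<dots> = s * (x $ i * (S - p))"
      by (simp only: nb'[OF i, symmetric] sum_distrib_left)
    finally show ?thesis by simp
  qed
  then have "\<bar>s * (S - p)\<bar> \<le> graph_spectral_radius n E w"
    unfolding graph_spectral_radius_def
    using abs_eigenvalue_le_spectral_radius[OF adj_mat_carrier uv(2), of "\<lambda>i. x $ i"] xu by blast
  moreover have "(spectral_bound n E w)\<^sup>2 = (S - p)\<^sup>2"
  proof -
    have cl: "cl n E e = r" if "e \<in> E" for e
      by (rule cl_complete_multipartite[OF mp X isol that])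
    have "(spectral_bound n E w)\<^sup>2
        = (\<Sum>i<n. \<Sum>j<n. ((real r - 1) / real r) * (x $ i * (x $ i * (if {i, j} \<in> E then (x $ j)\<^sup>2 else 0))))"
      unfolding spectral_bound_squared[OF G] using s
      by (intro sum.cong refl) (auto simp: edge_coeff_def cl w power_mult_distrib power2_eq_square)
    also have "\<dots> = (\<Sum>i<n. ((real r - 1) / real r) * (x $ i * (x $ i * (S - p))))"
      by (intro sum.cong refl)
        (simp only: sum_distrib_left[symmetric] nb' lessThan_iff)
    also have "\<dots> = ((real r - 1) / real r) * (S * (S - p))"
      by (simp add: S_def sum_distrib_left sum_distrib_right power2_eq_square mult_ac)
    \<comment> \<open>From S = r * p it follows that (r - 1)/r * S = S - p.\<close>
    also have "\<dots> = (S - p)\<^sup>2"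
      using r by (simp add: S field_simps power2_eq_square)
    finally show ?thesis .
  qed
  then have "spectral_bound n E w = \<bar>S - p\<bar>"
    using spectral_bound_nonneg[of n E w] by (metis abs_of_nonneg power2_eq_iff abs_minus_cancel)
  ultimately show ?thesis using s by (auto simp: abs_mult)
qed

section \<open>Equality forces the extremal structure\<close>

text \<open>A single part with the zero vector serves as witness; \<open>n \<ge> 1\<close> keeps
  that part nonempty.\<close>

lemma extremal_structure_edgeless:
  assumes "n \<ge> 1"
  shows "extremal_structure n {} w"
proof -
  have mp: "complete_multipartite {..<n} {} 1 (\<lambda>_. {..<n})"
    using assms by (auto simp: complete_multipartite_def disjoint_family_on_def lessThan_empty_iff)
  have x: "0\<^sub>v n \<in> carrier_vec n" by simp
  have "adj_mat n {} w = 1 \<cdot>\<^sub>m part_product_sum n (\<lambda>_. {..<n}) 1 (0\<^sub>v n)"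
  proof (rule eq_matI)
    fix i j
    assume "i < dim_row (1 \<cdot>\<^sub>m part_product_sum n (\<lambda>_. {..<n}) 1 (0\<^sub>v n))"
      "j < dim_col (1 \<cdot>\<^sub>m part_product_sum n (\<lambda>_. {..<n}) 1 (0\<^sub>v n))"
    then have ij: "i < n" "j < n" by (simp_all add: sum_of_mats_def)
    then show "adj_mat n {} w $$ (i, j) = (1 \<cdot>\<^sub>m part_product_sum n (\<lambda>_. {..<n}) 1 (0\<^sub>v n)) $$ (i, j)"
      using sum_of_outer_prods_index[OF mp x ij] by (simp add: adj_mat_index sum_of_mats_def)
  qed (simp_all add: adj_mat_def sum_of_mats_def)
  moreover have "euclidean_norm (hadamard_vec (char_vec n {..<n}) (0\<^sub>v n)) = 0"
    "euclidean_norm (0\<^sub>v n) = 0"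
    by (simp_all add: euclidean_norm_def hadamard_vec_def char_vec_def)
  ultimately show ?thesis
    unfolding extremal_structure_def complete_multipartite_up_to_isolated_def
    by (intro exI[of _ 1] exI[of _ "\<lambda>_. {..<n}"] conjI exI[of _ "{..<n}"] bexI[of _ "0\<^sub>v n"]
        bexI[of _ 1] mp x) auto
qed

text \<open>Nonadjacency is an equivalence relation on \<open>P\<close>, reflexive because there are
  no loops; its classes, numbered arbitrarily, are the parts.\<close>

lemma complete_multipartite_if_nonadjacency_trans:
  assumes fin: "finite P" and E: "\<And>e. e \<in> E \<Longrightarrow> \<exists>u v. e = {u, v} \<and> u \<noteq> v \<and> u \<in> P \<and> v \<in> P"
    and trans: "\<And>u v z. u \<in> P \<Longrightarrow> v \<in> P \<Longrightarrow> z \<in> P \<Longrightarrow> {u, v} \<notin> E \<Longrightarrow> {v, z} \<notin> E \<Longrightarrow> {u, z} \<notin> E"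
  obtains r V where "complete_multipartite P E r V"
proof -
  define R where "R = {(u, v). u \<in> P \<and> v \<in> P \<and> {u, v} \<notin> E}"
  have equiv: "equiv P R"
  proof (rule equivI)
    show "R \<subseteq> P \<times> P" by (auto simp: R_def)
    show "refl_on P R" using E by (auto simp: R_def refl_on_def doubleton_eq_iff)
    show "sym R" by (auto simp: R_def sym_def insert_commute)
    show "trans R" using trans by (auto simp: R_def trans_def)
  qed
  have "finite (P // R)" using fin by (simp add: quotient_def)
  then obtain V where V: "bij_betw V {..<card (P // R)} (P // R)"
    using ex_bij_betw_nat_finite by (metis lessThan_atLeast0)
  let ?r = "card (P // R)"
  have VQ: "V i \<in> P // R" if "i < ?r" for i
    using V that by (auto simp: bij_betw_def)
  have VP: "V i \<subseteq> P" if "i < ?r" for i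
    using VQ[OF that] equiv by (metis Sup_upper Union_quotient)
  have UV: "(\<Union>i<?r. V i) = P"
    using V Union_quotient[OF equiv] by (simp add: bij_betw_def)
  have inj: "i = j" if "i < ?r" "j < ?r" "V i = V j" for i j
    using V that by (auto simp: bij_betw_def inj_on_def)
  have same: "(u, v) \<in> R \<longleftrightarrow> i = j" if "i < ?r" "j < ?r" "u \<in> V i" "v \<in> V j" for u v i j
    using quotient_eq_iff[OF equiv VQ[OF that(1)] VQ[OF that(2)] that(3,4)] inj[OF that(1,2)] by blast
  have ne: "\<forall>i<?r. V i \<noteq> {}"
    using VQ in_quotient_imp_non_empty[OF equiv] by blast
  have disj: "disjoint_family_on V {..<?r}"
    unfolding disjoint_family_on_def
    using quotient_disj[OF equiv VQ VQ] inj by (metis lessThan_iff)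
  have "e \<in> E \<longleftrightarrow> (\<exists>u v. e = {u, v} \<and> (\<exists>i<?r. \<exists>j<?r. i \<noteq> j \<and> u \<in> V i \<and> v \<in> V j))" for e
  proof
    assume e: "e \<in> E"
    then obtain u v where uv: "e = {u, v}" "u \<in> P" "v \<in> P" using E by blast
    then obtain i j where ij: "i < ?r" "j < ?r" "u \<in> V i" "v \<in> V j" using UV by blast
    have "(u, v) \<notin> R" using e uv by (simp add: R_def)
    then show "\<exists>u v. e = {u, v} \<and> (\<exists>i<?r. \<exists>j<?r. i \<noteq> j \<and> u \<in> V i \<and> v \<in> V j)"
      using same[OF ij] ij uv by blast
  next
    assume "\<exists>u v. e = {u, v} \<and> (\<exists>i<?r. \<exists>j<?r. i \<noteq> j \<and> u \<in> V i \<and> v \<in> V j)"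
    then obtain u v i j where uv: "e = {u, v}" "i < ?r" "j < ?r" "i \<noteq> j" "u \<in> V i" "v \<in> V j" by blast
    then have "(u, v) \<notin> R" using same by blast
    then show "e \<in> E" using uv VP by (auto simp: R_def)
  qed
  then have "E = {{u, v} | u v. \<exists>i<?r. \<exists>j<?r. i \<noteq> j \<and> u \<in> V i \<and> v \<in> V j}"
    by blast
  then have "complete_multipartite P E ?r V"
    unfolding complete_multipartite_def using ne disj UV by blast
  then show ?thesis by (rule that)
qed

text \<open>Nonzero weights force both ends of every edge into the support \<open>P\<close> of the
  eigenvector. On \<open>P\<close> the optimality conditions yield the multipartite structure and
  equal parts, and a rescaled eigenvector is the required vector.\<close>

lemma graph_spectral_radius_eq_bound_imp_extremal:
  assumes n: "n \<ge> 1" and G: "simple_graph n E" and w0: "\<forall>e\<in>E. w e \<noteq> 0"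
    and eq: "graph_spectral_radius n E w = spectral_bound n E w"
  shows "extremal_structure n E w"
proof (cases "E = {}")
  case True
  then show ?thesis using extremal_structure_edgeless[OF n] by simp
next
  case False
  let ?b = "edge_coeff n E"
  obtain \<beta> x where q: "quad_form {..<n} ?b (\<lambda>i. (x i)\<^sup>2) = (\<Sum>i<n. (x i)\<^sup>2)\<^sup>2"
    and w: "\<And>i j. i < n \<Longrightarrow> j < n \<Longrightarrow> {i, j} \<in> E \<Longrightarrow> w {i, j} = \<beta> * ?b i j * x i * x j"
    using graph_spectral_radius_eq_boundD[OF n G eq] False w0 by blast
  define T where "T = (\<Sum>i<n. (x i)\<^sup>2)"
  define P where "P = {i. i < n \<and> x i \<noteq> 0}"
  have P: "finite P" "P \<subseteq> {..<n}" by (auto simp: P_def)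
  have endpoints: "\<exists>u v. e = {u, v} \<and> u \<noteq> v \<and> u \<in> P \<and> v \<in> P" if e: "e \<in> E" for e
  proof -
    obtain u v where uv: "e = {u, v}" "u \<noteq> v" "u < n" "v < n" using edgeE[OF G e] by blast
    then have "x u \<noteq> 0" "x v \<noteq> 0" using w[of u v] w0 e by auto
    then show ?thesis using uv by (auto simp: P_def)
  qed
  have maximizer: "quad_form {..<n} ?b y \<le> (\<Sum>u<n. y u)\<^sup>2" if "\<And>u. u \<in> {..<n} \<Longrightarrow> 0 \<le> y u" for y
    using quad_form_edge_coeff_le[OF G that] .
  have "{u, z} \<notin> E" if "u \<in> P" "v \<in> P" "z \<in> P" "{u, v} \<notin> E" "{v, z} \<notin> E" for u v z
  proof -
    have "?b u z \<le> 0"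
      using that P edge_coeff_sym edge_coeff_diag[OF G] maximizer
      by (intro quad_form_maximizer_nonadjacency_trans[OF _ _ _ maximizer _ q, of u v z])
        (auto simp: P_def edge_coeff_def insert_commute)
    then show ?thesis using edge_coeff_pos[OF G, of u z] by auto
  qed
  then obtain r V where mp: "complete_multipartite P E r V"
    using complete_multipartite_if_nonadjacency_trans[OF P(1) endpoints] by blast
  have isol: "\<forall>v \<in> {..<n} - P. \<forall>e\<in>E. v \<notin> e" using endpoints by blast
  have PV: "P = (\<Union>i<r. V i)" using mp by (auto simp: complete_multipartite_def)
  then have Vn: "V k \<subseteq> {..<n}" if "k < r" for k using P that by blast
  have cl: "cl n E e = r" if "e \<in> E" for e
    by (rule cl_complete_multipartite[OF mp P(2) isol that])
  obtain e0 where e0: "e0 \<in> E" using False by blast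
  have r: "r \<ge> 2" using two_le_cl[OF G e0] cl[OF e0] by simp
  obtain u0 where "u0 \<in> P" using endpoints[OF e0] by blast
  then have T: "T > 0" unfolding T_def by (intro sum_pos2[of _ u0]) (auto simp: P_def)
  \<comment> \<open>The common value of the edge coefficients, since every edge has clique number
    \<open>r\<close>.\<close>
  define c where "c = real r / (real r - 1)"
  have c: "c > 0" using r by (simp add: c_def)
  have b: "?b i j = (if {i, j} \<in> E then c else 0)" for i j
    by (simp add: edge_coeff_def cl c_def)
  have part: "(\<Sum>j\<in>V k. (x j)\<^sup>2) = T / real r" if k: "k < r" for k
  proof -
    obtain i where i: "i \<in> V k" using mp k by (auto simp: complete_multipartite_def)
    then have "i \<in> P" using PV k by blast
    \<comment> \<open>The first-order condition at \<open>i\<close> reads T = c * (T - part sum),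
      and 1 - 1/c = 1/r.\<close>
    then have "T = (\<Sum>j<n. (x j)\<^sup>2 * ?b i j)"
      unfolding T_def using edge_coeff_sym edge_coeff_diag[OF G]
      by (intro quad_form_gradient_at_maximizer[OF _ _ _ maximizer _ q, symmetric]) (auto simp: P_def)
    also have "\<dots> = c * (\<Sum>j<n. if {i, j} \<in> E then (x j)\<^sup>2 else 0)"
      unfolding sum_distrib_left by (intro sum.cong) (auto simp: b)
    also have "(\<Sum>j<n. if {i, j} \<in> E then (x j)\<^sup>2 else 0) = T - (\<Sum>j\<in>V k. (x j)\<^sup>2)"
      unfolding T_def
      by (rule complete_multipartite_neighbour_sum[OF mp P(2) _ k i]) (auto simp: P_def)
    finally show ?thesis using r by (simp add: c_def field_simps)
  qed
  \<comment> \<open>Scaled so that z i * z j = \<bar>\<beta>\<bar> * c * x i * x j, which is the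
    edge weight up to the sign \<open>s\<close>.\<close>
  define z where "z = vec n (\<lambda>i. sqrt (\<bar>\<beta>\<bar> * c) * x i)"
  have z: "z \<in> carrier_vec n" by (simp add: z_def)
  have zi: "z $ i = sqrt (\<bar>\<beta>\<bar> * c) * x i" if "i < n" for i using that by (simp add: z_def)
  have zz: "z $ i * z $ j = \<bar>\<beta>\<bar> * c * (x i * x j)" if "i < n" "j < n" for i j
  proof -
    have "z $ i * z $ j = (sqrt (\<bar>\<beta>\<bar> * c))\<^sup>2 * (x i * x j)"
      unfolding zi[OF that(1)] zi[OF that(2)] by (simp only: power2_eq_square mult_ac)
    then show ?thesis using c by simp
  qed
  define s :: real where "s = (if \<beta> \<ge> 0 then 1 else - 1)"
  have s: "s \<in> {1, -1}" "s * \<bar>\<beta>\<bar> = \<beta>" by (auto simp: s_def)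
  have mat: "adj_mat n E w = s \<cdot>\<^sub>m part_product_sum n V r z"
  proof (rule eq_matI)
    fix i j assume "i < dim_row (s \<cdot>\<^sub>m part_product_sum n V r z)" "j < dim_col (s \<cdot>\<^sub>m part_product_sum n V r z)"
    then have ij: "i < n" "j < n" by (simp_all add: sum_of_mats_def)
    have "(s \<cdot>\<^sub>m part_product_sum n V r z) $$ (i, j) = s * part_product_sum n V r z $$ (i, j)"
      using ij by (simp add: sum_of_mats_def)
    also have "\<dots> = s * (if {i, j} \<in> E then z $ i * z $ j else 0)"
      by (subst sum_of_outer_prods_index_supported[OF mp z ij]) (auto simp: zi P_def)
    also have "\<dots> = adj_mat n E w $$ (i, j)"
      using s(2) by (auto simp: adj_mat_index ij zz w b mult.assoc[symmetric])
    finally show "adj_mat n E w $$ (i, j) = (s \<cdot>\<^sub>m part_product_sum n V r z) $$ (i, j)" by simp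
  qed (simp_all add: adj_mat_def sum_of_mats_def)
  \<comment> \<open>Of the two factors c in a squared weight, one is kept as \<open>?b i j\<close>,
    so the sum becomes the quadratic form, whose value is T^2.\<close>
  have "(frobenius_norm (adj_mat n E w))\<^sup>2
      = (\<Sum>i<n. \<Sum>j<n. (\<beta>\<^sup>2 * c) * ((x i)\<^sup>2 * ((x j)\<^sup>2 * ?b i j)))"
    unfolding frobenius_norm_adj_mat_squared
    by (intro sum.cong refl) (auto simp: w b power2_eq_square)
  also have "\<dots> = (\<beta>\<^sup>2 * c) * T\<^sup>2"
    unfolding T_def q[symmetric] quad_form_def by (simp only: sum_distrib_left)
  also have "\<dots> = (\<bar>\<beta>\<bar> * sqrt c * T)\<^sup>2"
    using c by (simp add: power_mult_distrib)
  finally have frob: "frobenius_norm (adj_mat n E w) = \<bar>\<beta>\<bar> * sqrt c * T"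
    by (rule power2_eq_imp_eq) (use c T in \<open>auto simp: frobenius_norm_def sum_nonneg\<close>)
  have "1 - 1 / real r = 1 / c" using r by (simp add: c_def field_simps)
  then have "sqrt (1 - 1 / real r) * sqrt c = 1"
    using c by (simp add: real_sqrt_divide)
  then have frob': "sqrt (1 - 1 / real r) * frobenius_norm (adj_mat n E w) = \<bar>\<beta>\<bar> * T"
    unfolding frob by (simp add: mult_ac)
  have norms: "(euclidean_norm (hadamard_vec (char_vec n (V k)) z))\<^sup>2
      = (euclidean_norm z)\<^sup>2 - sqrt (1 - 1 / real r) * frobenius_norm (adj_mat n E w)" if k: "k < r" for k
  proof -
    have "(euclidean_norm z)\<^sup>2 = \<bar>\<beta>\<bar> * c * T"
      unfolding euclidean_norm_squared[OF z] T_def sum_distrib_left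
      by (intro sum.cong refl) (simp add: power2_eq_square zz)
    moreover have "(euclidean_norm (hadamard_vec (char_vec n (V k)) z))\<^sup>2 = \<bar>\<beta>\<bar> * c * (T / real r)"
      unfolding euclidean_norm_restrict_squared[OF z Vn[OF k]] part[OF k, symmetric] sum_distrib_left
      using Vn[OF k] by (intro sum.cong refl) (auto simp: power2_eq_square zz subset_iff)
    moreover have "\<bar>\<beta>\<bar> * c * (T / real r) = \<bar>\<beta>\<bar> * c * T - \<bar>\<beta>\<bar> * T"
      using r by (simp add: c_def field_simps)
    ultimately show ?thesis unfolding frob' by simp
  qed
  have "complete_multipartite_up_to_isolated n E r V"
    unfolding complete_multipartite_up_to_isolated_def using P(2) isol mp by blast
  then show ?thesis
    unfolding extremal_structure_def using r z s(1) mat norms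
    by (intro exI[of _ r] conjI exI[of _ V] bexI[of _ z] bexI[of _ s]) auto
qed

text \<open>An edge of weight 0 changes the graph but not the matrix: one weighted edge together
  with a disjoint edge of weight 0 attains the bound without being complete multipartite. Hence the
  equivalence is stated for nonzero weights.\<close>

theorem theorem1p1:
  fixes n :: nat and E :: "nat set set" and w :: "nat set \<Rightarrow> real"
  assumes "n \<ge> 1" and "simple_graph n E"
  defines "bound \<equiv> sqrt (2 * (\<Sum>e\<in>E. (real (cl n E e) - 1) / real (cl n E e) * (w e)\<^sup>2))"
  shows "graph_spectral_radius n E w \<le> bound
    \<and> (extremal_structure n E w \<longrightarrow> graph_spectral_radius n E w = bound)
    \<and> ((\<forall>e\<in>E. w e \<noteq> 0) \<longrightarrow>
         (graph_spectral_radius n E w = bound \<longleftrightarrow> extremal_structure n E w))"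
proof -
  have "bound = spectral_bound n E w" by (simp add: bound_def spectral_bound_def)
  then show ?thesis
    using graph_spectral_radius_le[OF assms(1,2), of w]
      extremal_structure_imp_bound_le[OF assms(1,2), of w]
      graph_spectral_radius_eq_bound_imp_extremal[OF assms(1,2), of w]
    by (auto intro: antisym)
qed

end
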